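(* Let $\kappa>2$ be an integer, $\rho\in(0,1)$, $\mathcal{E}\in(\rho,\kappa\rho)$, $\alpha_p\in\mathbb{R}$ and $\alpha_e\neq0$. Then the coefficients $\mathbf{G}^1_{22}$ and $\mathbf{G}^2_{11}$ of the coupling matrices are always non-zero. Moreover, there exists some choice of the parameters $(\alpha_p,\alpha_e,\kappa,\rho,\mathcal{E})$ satisfying these conditions for which all the diagonal entries $\mathbf{G}^1_{11},\mathbf{G}^1_{22},\mathbf{G}^2_{11},\mathbf{G}^2_{22}$ of the coupling matrices are non-zero.
   Context: Let $$\chi(\rho,\mathcal{E})=\begin{pmatrix}\rho(1-\rho)&\mathcal{E}(1-\rho)\\ \mathcal{E}(1-\rho)&\frac{(\mathcal{E}-\rho)(\kappa\rho-\mathcal{E})}{(\kappa-1)\rho}+\frac{(1-\rho)\mathcal{E}^2}{\rho}\end{pmatrix},\qquad \mathbf{j}(\rho,\mathcal{E})=(\kappa-1)\chi(\rho,\mathcal{E})\begin{pmatrix}\alpha_p\\ \alpha_e\end{pmatrix}.$$ $\mathbf{J}$ is the Jacobian matrix of $\mathbf{j}$ with respect to $(\rho,\mathcal{E})$ and $\mathbf{H}^i$ ($i=1,2$) is the Hessian matrix of the coordinate $\mathbf{j}_i$. When $\alpha_e\neq0$, $\mathbf{J}$ has two distinct real eigenvalues $\lambda_1>\lambda_2$, with left eigenvectors normalized as $\begin{pmatrix}\mathfrak{c}_i&1\end{pmatrix}\mathbf{J}=\lambda_i\begin{pmatrix}\mathfrak{c}_i&1\end{pmatrix}$, $\mathfrak{c}_1\ne\mathfrak{c}_2$.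 Put $R=\begin{pmatrix}\mathfrak{c}_1&1\\ \mathfrak{c}_2&1\end{pmatrix}$. The coupling matrices are $$\mathbf{G}^i=\frac12\sum_{j=1}^2R_{ij}(R^{-1})^\top\mathbf{H}^jR^{-1}=\frac12(R^{-1})^\top(\mathfrak{c}_i\mathbf{H}^1+\mathbf{H}^2)R^{-1},\qquad i=1,2.$$ *)

theory Defs
  imports "HOL-Analysis.Analysis"
begin

text \<open>
  A point \<open>u :: real^2\<close> is the pair of densities \<open>(\<rho>, \<E>)\<close>, and \<open>a :: real^2\<close> is the pair
  of parameters \<open>(\<alpha>\<^sub>p, \<alpha>\<^sub>e)\<close>.
\<close>

definition chi :: "real \<Rightarrow> real^2 \<Rightarrow> real^2^2" where
  "chi \<kappa> u = (let \<rho> = u $ 1; \<E> = u $ 2 in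
     vector [vector [\<rho> * (1 - \<rho>), \<E> * (1 - \<rho>)],
             vector [\<E> * (1 - \<rho>),
                     (\<E> - \<rho>) * (\<kappa> * \<rho> - \<E>) / ((\<kappa> - 1) * \<rho>) + (1 - \<rho>) * \<E>\<^sup>2 / \<rho>]])"

definition flux :: "real \<Rightarrow> real^2 \<Rightarrow> real^2 \<Rightarrow> real^2" where
  "flux \<kappa> a u = (\<kappa> - 1) *\<^sub>R (chi \<kappa> u *v a)"

definition flux_jacobian :: "real \<Rightarrow> real^2 \<Rightarrow> real^2 \<Rightarrow> real^2^2" where
  "flux_jacobian \<kappa> a u = jacobian (flux \<kappa> a) (at u)"

definition grad :: "(real^'n \<Rightarrow> real) \<Rightarrow> real^'n \<Rightarrow> real^'n" where
  "grad f x = (\<chi> k. frechet_derivative f (at x) (axis k 1))"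

definition hessian :: "(real^'n \<Rightarrow> real) \<Rightarrow> real^'n \<Rightarrow> real^'n^'n" where
  "hessian f x = jacobian (grad f) (at x)"

definition flux_hessian :: "real \<Rightarrow> real^2 \<Rightarrow> real^2 \<Rightarrow> 2 \<Rightarrow> real^2^2" where
  "flux_hessian \<kappa> a u i = hessian (\<lambda>w. flux \<kappa> a w $ i) u"

definition eigenvalues :: "real^'n^'n \<Rightarrow> real set" where
  "eigenvalues A = {l. \<exists>v. v \<noteq> 0 \<and> A *v v = l *\<^sub>R v}"

text \<open>
  The two real eigenvalues are labelled so that \<open>\<lambda>\<^sub>1 > \<lambda>\<^sub>2\<close>. The operators \<open>Max\<close>, \<open>Min\<close> and
  \<open>THE\<close> are meaningful because, for \<open>\<alpha>\<^sub>e \<noteq> 0\<close> and \<open>u\<close> in the admissible domain, the Jacobian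
  has two distinct real eigenvalues and each has exactly one left eigenvector with second
  component 1.
\<close>

definition flux_eigenvalue :: "real \<Rightarrow> real^2 \<Rightarrow> real^2 \<Rightarrow> 2 \<Rightarrow> real" where
  "flux_eigenvalue \<kappa> a u i =
     (if i = 1 then Max (eigenvalues (flux_jacobian \<kappa> a u))
      else Min (eigenvalues (flux_jacobian \<kappa> a u)))"

definition left_coeff :: "real \<Rightarrow> real^2 \<Rightarrow> real^2 \<Rightarrow> 2 \<Rightarrow> real" where
  "left_coeff \<kappa> a u i =
     (THE c. vector [c, 1] v* flux_jacobian \<kappa> a u = flux_eigenvalue \<kappa> a u i *\<^sub>R vector [c, 1])"

definition Rmat :: "real \<Rightarrow> real^2 \<Rightarrow> real^2 \<Rightarrow> real^2^2" where
  "Rmat \<kappa> a u = vector [vector [left_coeff \<kappa> a u 1, 1], vector [left_coeff \<kappa> a u 2, 1]]"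

definition coupling :: "real \<Rightarrow> real^2 \<Rightarrow> real^2 \<Rightarrow> 2 \<Rightarrow> real^2^2" where
  "coupling \<kappa> a u i = (let R = Rmat \<kappa> a u in
     (1/2) *\<^sub>R (\<Sum>j\<in>UNIV. (R $ i $ j) *\<^sub>R
       (transpose (matrix_inv R) ** flux_hessian \<kappa> a u j ** matrix_inv R)))"

definition admissible :: "int \<Rightarrow> real \<Rightarrow> real \<Rightarrow> real \<Rightarrow> real \<Rightarrow> bool" where
  "admissible \<kappa> \<rho> \<E> \<alpha>\<^sub>p \<alpha>\<^sub>e \<longleftrightarrow>
     \<kappa> > 2 \<and> 0 < \<rho> \<and> \<rho> < 1 \<and> \<rho> < \<E> \<and> \<E> < of_int \<kappa> * \<rho> \<and> \<alpha>\<^sub>e \<noteq> 0"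

abbreviation G :: "int \<Rightarrow> real \<Rightarrow> real \<Rightarrow> real \<Rightarrow> real \<Rightarrow> 2 \<Rightarrow> real^2^2" where
  "G \<kappa> \<rho> \<E> \<alpha>\<^sub>p \<alpha>\<^sub>e \<equiv> coupling (of_int \<kappa>) (vector [\<alpha>\<^sub>p, \<alpha>\<^sub>e]) (vector [\<rho>, \<E>])"

end

theory Submission
  imports Defs
begin

text \<open>
  Write \<open>x = \<E> / \<rho>\<close>. The coefficients \<open>c\<^sub>1, c\<^sub>2\<close> of the left eigenvectors are the roots
  of a quadratic with leading coefficient \<open>J\<^sub>1\<^sub>2 = (\<kappa> - 1) \<alpha>\<^sub>e (1 - \<rho>)\<close>, whose value at
  \<open>-x\<close> is \<open>\<alpha>\<^sub>e (x - 1) (x - \<kappa>)\<close>. These two have opposite signs, so \<open>-x\<close> lies strictly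
  between two distinct real roots. Up to affine terms the flux is
  \<open>-(\<kappa> - 1) (\<alpha>\<^sub>p \<rho> + \<alpha>\<^sub>e \<E>) (\<rho>, \<E>) + (0, (\<kappa> - 2) \<alpha>\<^sub>e \<E>\<^sup>2 / \<rho>)\<close>. The second derivative of the
  first summand along \<open>v\<close> is a multiple of \<open>v\<close>, hence is annihilated by the left eigenvector
  \<open>(c\<^sub>i, 1)\<close> orthogonal to \<open>v\<close>; the second summand contributes a nonzero multiple of
  \<open>(c\<^sub>i + x)\<^sup>2\<close> to the two coefficients \<open>G\<^sup>1\<^sub>2\<^sub>2\<close> and \<open>G\<^sup>2\<^sub>1\<^sub>1\<close>.
\<close>

section \<open>Jacobians, gradients and Hessians in the plane from explicit derivatives\<close>

lemma matrix_2_eqI: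
  fixes A B :: "'a^2^2"
  assumes "A $ 1 $ 1 = B $ 1 $ 1" "A $ 1 $ 2 = B $ 1 $ 2"
    "A $ 2 $ 1 = B $ 2 $ 1" "A $ 2 $ 2 = B $ 2 $ 2"
  shows "A = B"
  using assms by (simp add: vec_eq_iff forall_2)

lemma jacobian_2:
  fixes f :: "real^2 \<Rightarrow> real^2"
  assumes "((\<lambda>x. f x $ 1) has_derivative (\<lambda>h. a * h $ 1 + b * h $ 2)) (at u)"
    and "((\<lambda>x. f x $ 2) has_derivative (\<lambda>h. c * h $ 1 + d * h $ 2)) (at u)"
  shows "jacobian f (at u) = vector [vector [a, b], vector [c, d]]"
proof -
  let ?D = "\<lambda>h::real^2. (vector [a * h $ 1 + b * h $ 2, c * h $ 1 + d * h $ 2] :: real^2)"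
  have "(f has_derivative ?D) (at u)"
  proof (subst has_derivative_componentwise_within, rule ballI)
    fix i :: "real^2"
    assume "i \<in> Basis"
    then have "i = axis 1 1 \<or> i = axis 2 1"
      by (auto simp: Basis_vec_def) (metis exhaust_2)
    then show "((\<lambda>x. f x \<bullet> i) has_derivative (\<lambda>h. ?D h \<bullet> i)) (at u)"
      using assms by (elim disjE) (simp_all add: inner_axis)
  qed
  from frechet_derivative_at[OF this] have "frechet_derivative f (at u) = ?D"
    by (rule sym)
  then show ?thesis
    unfolding jacobian_def by (intro matrix_2_eqI) (simp_all add: matrix_def axis_def)
qed

lemma grad_2:
  fixes f :: "real^2 \<Rightarrow> real"
  assumes "(f has_derivative (\<lambda>h. a * h $ 1 + b * h $ 2)) (at u)"
  shows "grad f u = vector [a, b]"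
proof -
  have "frechet_derivative f (at u) = (\<lambda>h. a * h $ 1 + b * h $ 2)"
    by (rule frechet_derivative_at[OF assms, symmetric])
  then show ?thesis
    by (simp add: grad_def vec_eq_iff forall_2 axis_def)
qed

text \<open>The Hessian differentiates \<open>grad f\<close>, so the gradient has to be known on a
  whole neighbourhood \<open>S\<close> of \<open>u\<close>. Leaving \<open>S\<close> free allows
  formulas that are valid only off the line \<open>w $ 1 = 0\<close>.\<close>

lemma hessian_2:
  fixes f :: "real^2 \<Rightarrow> real"
  assumes S: "open S" "u \<in> S"
    and f: "\<And>w. w \<in> S \<Longrightarrow> (f has_derivative (\<lambda>h. g w * h $ 1 + k w * h $ 2)) (at w)"
    and g: "(g has_derivative (\<lambda>h. a * h $ 1 + b * h $ 2)) (at u)"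
    and k: "(k has_derivative (\<lambda>h. c * h $ 1 + d * h $ 2)) (at u)"
  shows "hessian f u = vector [vector [a, b], vector [c, d]]"
proof -
  have *: "grad f w = vector [g w, k w]" if "w \<in> S" for w
    using f[OF that] by (rule grad_2)
  have "((\<lambda>w. grad f w $ 1) has_derivative (\<lambda>h. a * h $ 1 + b * h $ 2)) (at u)"
    by (rule has_derivative_transform_within_open[OF g S]) (simp add: *)
  moreover have "((\<lambda>w. grad f w $ 2) has_derivative (\<lambda>h. c * h $ 1 + d * h $ 2)) (at u)"
    by (rule has_derivative_transform_within_open[OF k S]) (simp add: *)
  ultimately show ?thesis
    unfolding hessian_def by (rule jacobian_2)
qed

section \<open>Closed forms of the flux and its derivatives\<close>

lemma flux_1: "flux \<kappa> a w $ 1 = (\<kappa> - 1) * (1 - w $ 1) * (a $ 1 * w $ 1 + a $ 2 * w $ 2)"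
  by (simp add: flux_def chi_def Let_def matrix_vector_mult_def sum_2 algebra_simps)

text \<open>The factor \<open>\<kappa> - 1\<close> cancels the one in the denominator inside
  \<open>chi\<close>. What remains is polynomial except for a multiple of
  \<open>(w $ 2)\<^sup>2 / w $ 1\<close>.\<close>

lemma flux_2:
  assumes "\<kappa> \<noteq> 1" "w $ 1 \<noteq> 0"
  shows "flux \<kappa> a w $ 2 = (\<kappa> - 1) * w $ 2 * (a $ 1 - a $ 1 * w $ 1 - a $ 2 * w $ 2)
    + a $ 2 * ((\<kappa> + 1) * w $ 2 - \<kappa> * w $ 1 + (\<kappa> - 2) * (w $ 2)\<^sup>2 / w $ 1)"
proof -
  have "flux \<kappa> a w $ 2 = (\<kappa> - 1) * (w $ 2 * (1 - w $ 1) * a $ 1 +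
      ((w $ 2 - w $ 1) * (\<kappa> * w $ 1 - w $ 2) / ((\<kappa> - 1) * w $ 1)
        + (1 - w $ 1) * (w $ 2)\<^sup>2 / w $ 1) * a $ 2)"
    by (simp add: flux_def chi_def Let_def matrix_vector_mult_def sum_2)
  then show ?thesis
    using assms by (simp add: divide_simps) (simp add: algebra_simps power2_eq_square)
qed

lemma open_nonzero_component: "open {w :: real^'n. w $ i \<noteq> 0}"
  by (intro open_Collect_neq continuous_intros)

lemma has_derivative_vec_nth: "((\<lambda>w. w $ i) has_derivative (\<lambda>h. h $ i)) F"
  by (rule bounded_linear_imp_has_derivative) (rule bounded_linear_vec_nth)

lemma flux_1_has_derivative:
  "((\<lambda>w. flux \<kappa> a w $ 1) has_derivative
     (\<lambda>h. (\<kappa> - 1) * (a $ 1 - 2 * a $ 1 * w $ 1 - a $ 2 * w $ 2) * h $ 1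
        + (\<kappa> - 1) * a $ 2 * (1 - w $ 1) * h $ 2)) (at w)"
  unfolding flux_1
  by (rule has_derivative_vec_nth derivative_eq_intros refl)+
     (simp add: algebra_simps)

lemma flux_2_has_derivative:
  assumes "\<kappa> \<noteq> 1" "w $ 1 \<noteq> 0"
  shows "((\<lambda>w. flux \<kappa> a w $ 2) has_derivative
     (\<lambda>h. (- (\<kappa> - 1) * a $ 1 * w $ 2 - a $ 2 * \<kappa>
            - (\<kappa> - 2) * a $ 2 * (w $ 2)\<^sup>2 / (w $ 1)\<^sup>2) * h $ 1
        + ((\<kappa> - 1) * (a $ 1 - a $ 1 * w $ 1 - 2 * a $ 2 * w $ 2) + a $ 2 * (\<kappa> + 1)
            + 2 * (\<kappa> - 2) * a $ 2 * w $ 2 / w $ 1) * h $ 2)) (at w)"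
\<comment> \<open>The closed form holds only where \<open>w $ 1\<close> is nonzero; this set is
  open, so the derivative carries over to \<open>flux\<close>.\<close>
proof (rule has_derivative_transform_within_open[OF _ open_nonzero_component])
  show "((\<lambda>w. (\<kappa> - 1) * w $ 2 * (a $ 1 - a $ 1 * w $ 1 - a $ 2 * w $ 2)
    + a $ 2 * ((\<kappa> + 1) * w $ 2 - \<kappa> * w $ 1 + (\<kappa> - 2) * (w $ 2)\<^sup>2 / w $ 1)) has_derivative
     (\<lambda>h. (- (\<kappa> - 1) * a $ 1 * w $ 2 - a $ 2 * \<kappa>
            - (\<kappa> - 2) * a $ 2 * (w $ 2)\<^sup>2 / (w $ 1)\<^sup>2) * h $ 1
        + ((\<kappa> - 1) * (a $ 1 - a $ 1 * w $ 1 - 2 * a $ 2 * w $ 2) + a $ 2 * (\<kappa> + 1)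
            + 2 * (\<kappa> - 2) * a $ 2 * w $ 2 / w $ 1) * h $ 2)) (at w)"
    by (rule has_derivative_vec_nth derivative_eq_intros refl assms)+
       (use assms in \<open>simp add: fun_eq_iff divide_simps\<close>, simp add: algebra_simps power2_eq_square)
qed (use assms in \<open>auto simp: flux_2\<close>)

lemma flux_jacobian_eq:
  assumes "\<kappa> \<noteq> 1" "u $ 1 \<noteq> 0"
  shows "flux_jacobian \<kappa> a u = vector
    [vector [(\<kappa> - 1) * (a $ 1 - 2 * a $ 1 * u $ 1 - a $ 2 * u $ 2),
             (\<kappa> - 1) * a $ 2 * (1 - u $ 1)],
     vector [- (\<kappa> - 1) * a $ 1 * u $ 2 - a $ 2 * \<kappa>
               - (\<kappa> - 2) * a $ 2 * (u $ 2)\<^sup>2 / (u $ 1)\<^sup>2,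
             (\<kappa> - 1) * (a $ 1 - a $ 1 * u $ 1 - 2 * a $ 2 * u $ 2) + a $ 2 * (\<kappa> + 1)
               + 2 * (\<kappa> - 2) * a $ 2 * u $ 2 / u $ 1]]"
  unfolding flux_jacobian_def
  by (intro jacobian_2 flux_1_has_derivative flux_2_has_derivative assms)

lemma flux_hessian_1:
  "flux_hessian \<kappa> a u 1 = vector
    [vector [- 2 * (\<kappa> - 1) * a $ 1, - (\<kappa> - 1) * a $ 2],
     vector [- (\<kappa> - 1) * a $ 2, 0]]"
  unfolding flux_hessian_def
  apply (rule hessian_2[OF open_UNIV UNIV_I flux_1_has_derivative])
  by (rule has_derivative_vec_nth derivative_eq_intros refl
      | simp add: algebra_simps)+

lemma flux_hessian_2:
  assumes "\<kappa> \<noteq> 1" "u $ 1 \<noteq> 0"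
  shows "flux_hessian \<kappa> a u 2 = vector
    [vector [2 * (\<kappa> - 2) * a $ 2 * (u $ 2)\<^sup>2 / (u $ 1) ^ 3,
             - (\<kappa> - 1) * a $ 1 - 2 * (\<kappa> - 2) * a $ 2 * u $ 2 / (u $ 1)\<^sup>2],
     vector [- (\<kappa> - 1) * a $ 1 - 2 * (\<kappa> - 2) * a $ 2 * u $ 2 / (u $ 1)\<^sup>2,
             - 2 * (\<kappa> - 1) * a $ 2 + 2 * (\<kappa> - 2) * a $ 2 / u $ 1]]"
  unfolding flux_hessian_def
proof (rule hessian_2[OF open_nonzero_component _ flux_2_has_derivative])
  show "((\<lambda>w. - (\<kappa> - 1) * a $ 1 * w $ 2 - a $ 2 * \<kappa>
            - (\<kappa> - 2) * a $ 2 * (w $ 2)\<^sup>2 / (w $ 1)\<^sup>2) has_derivative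
     (\<lambda>h. 2 * (\<kappa> - 2) * a $ 2 * (u $ 2)\<^sup>2 / (u $ 1) ^ 3 * h $ 1
        + (- (\<kappa> - 1) * a $ 1 - 2 * (\<kappa> - 2) * a $ 2 * u $ 2 / (u $ 1)\<^sup>2) * h $ 2)) (at u)"
    apply (rule has_derivative_vec_nth derivative_eq_intros refl power_not_zero assms)+
    using assms by (simp add: fun_eq_iff divide_simps) (simp add: algebra_simps eval_nat_numeral)
  show "((\<lambda>w. (\<kappa> - 1) * (a $ 1 - a $ 1 * w $ 1 - 2 * a $ 2 * w $ 2) + a $ 2 * (\<kappa> + 1)
            + 2 * (\<kappa> - 2) * a $ 2 * w $ 2 / w $ 1) has_derivative
     (\<lambda>h. (- (\<kappa> - 1) * a $ 1 - 2 * (\<kappa> - 2) * a $ 2 * u $ 2 / (u $ 1)\<^sup>2) * h $ 1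
        + (- 2 * (\<kappa> - 1) * a $ 2 + 2 * (\<kappa> - 2) * a $ 2 / u $ 1) * h $ 2)) (at u)"
    apply (rule has_derivative_vec_nth derivative_eq_intros refl assms)+
    using assms by (simp add: fun_eq_iff divide_simps) (simp add: algebra_simps power2_eq_square)
qed (use assms in auto)

section \<open>Eigenvalues and normalized left eigenvectors of a 2 by 2 matrix\<close>

lemma eigenvalue_2_iff:
  fixes A :: "real^2^2"
  assumes "A $ 1 $ 2 \<noteq> 0"
  shows "l \<in> eigenvalues A \<longleftrightarrow> (l - A $ 1 $ 1) * (l - A $ 2 $ 2) = A $ 1 $ 2 * A $ 2 $ 1"
proof
  assume "l \<in> eigenvalues A"
  then obtain v where v: "v \<noteq> 0" "A *v v = l *\<^sub>R v"
    by (auto simp: eigenvalues_def)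
  have 1: "A $ 1 $ 2 * v $ 2 = (l - A $ 1 $ 1) * v $ 1"
    using arg_cong[OF v(2), of "\<lambda>w. w $ 1"]
    by (simp add: matrix_vector_mult_def sum_2 algebra_simps)
  have 2: "A $ 2 $ 1 * v $ 1 = (l - A $ 2 $ 2) * v $ 2"
    using arg_cong[OF v(2), of "\<lambda>w. w $ 2"]
    by (simp add: matrix_vector_mult_def sum_2 algebra_simps)
  \<comment> \<open>If \<open>v $ 1\<close> were zero, equation \<open>1\<close> would force
    \<open>v $ 2 = 0\<close> as well.\<close>
  have "v $ 1 \<noteq> 0"
    using 1 assms v(1) by (auto simp: vec_eq_iff forall_2)
  moreover have "(l - A $ 1 $ 1) * (l - A $ 2 $ 2) * v $ 1 = A $ 1 $ 2 * A $ 2 $ 1 * v $ 1"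
    using 1 2 by algebra
  ultimately show "(l - A $ 1 $ 1) * (l - A $ 2 $ 2) = A $ 1 $ 2 * A $ 2 $ 1"
    by simp
next
  assume *: "(l - A $ 1 $ 1) * (l - A $ 2 $ 2) = A $ 1 $ 2 * A $ 2 $ 1"
  \<comment> \<open>This vector solves the first row of the eigenvalue equation identically; the
    second row is then the characteristic equation.\<close>
  let ?v = "vector [A $ 1 $ 2, l - A $ 1 $ 1] :: real^2"
  have "?v \<noteq> 0"
    using assms by (metis vector_2(1) zero_index)
  moreover have "A *v ?v = l *\<^sub>R ?v"
    using * by (simp add: vec_eq_iff forall_2 matrix_vector_mult_def sum_2 algebra_simps)
  ultimately show "l \<in> eigenvalues A"
    by (auto simp: eigenvalues_def)
qed

text \<open>If \<open>(c, 1)\<close> is a left eigenvector, its second component forces the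
  eigenvalue \<open>A $ 1 $ 2 * c + A $ 2 $ 2\<close>, and the first component becomes the quadratic
  in \<open>c\<close>. Under this affine substitution the characteristic polynomial is
  \<open>A $ 1 $ 2\<close> times that quadratic.\<close>

lemma eigenvalues_2:
  fixes A :: "real^2^2"
  assumes "A $ 1 $ 2 \<noteq> 0"
    and "\<And>c. A $ 1 $ 2 * c\<^sup>2 + (A $ 2 $ 2 - A $ 1 $ 1) * c - A $ 2 $ 1
           = A $ 1 $ 2 * (c - c\<^sub>1) * (c - c\<^sub>2)"
  shows "eigenvalues A = {A $ 1 $ 2 * c\<^sub>1 + A $ 2 $ 2, A $ 1 $ 2 * c\<^sub>2 + A $ 2 $ 2}"
proof -
  have "l \<in> eigenvalues A \<longleftrightarrow> l = A $ 1 $ 2 * c\<^sub>1 + A $ 2 $ 2 \<or> l = A $ 1 $ 2 * c\<^sub>2 + A $ 2 $ 2" for l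
  proof -
    define c where "c = (l - A $ 2 $ 2) / A $ 1 $ 2"
    then have l: "l = A $ 1 $ 2 * c + A $ 2 $ 2"
      using assms(1) by simp
    have "l \<in> eigenvalues A \<longleftrightarrow> (l - A $ 1 $ 1) * (l - A $ 2 $ 2) - A $ 1 $ 2 * A $ 2 $ 1 = 0"
      using assms(1) by (simp add: eigenvalue_2_iff)
    also have "(l - A $ 1 $ 1) * (l - A $ 2 $ 2) - A $ 1 $ 2 * A $ 2 $ 1
        = A $ 1 $ 2 * (A $ 1 $ 2 * c\<^sup>2 + (A $ 2 $ 2 - A $ 1 $ 1) * c - A $ 2 $ 1)"
      unfolding l by algebra
    also have "\<dots> = 0 \<longleftrightarrow> c = c\<^sub>1 \<or> c = c\<^sub>2"
      unfolding assms(2) using assms(1) by simp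
    finally show ?thesis
      using assms(1) by (simp add: l)
  qed
  then show ?thesis by auto
qed

text \<open>The two eigenvalues differ by \<open>A $ 1 $ 2 * (c\<^sub>1 - c\<^sub>2)\<close>, so
  \<open>less\<close> says that \<open>c\<^sub>1\<close> belongs to the larger one, whatever the
  sign of \<open>A $ 1 $ 2\<close>.\<close>

lemma left_coeff_eq:
  assumes "\<kappa> \<noteq> 1" "u $ 1 \<noteq> 0" and A: "A = flux_jacobian \<kappa> a u"
    and roots: "\<And>c. A $ 1 $ 2 * c\<^sup>2 + (A $ 2 $ 2 - A $ 1 $ 1) * c - A $ 2 $ 1
           = A $ 1 $ 2 * (c - c\<^sub>1) * (c - c\<^sub>2)"
    and less: "A $ 1 $ 2 * c\<^sub>2 < A $ 1 $ 2 * c\<^sub>1"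
  shows "left_coeff \<kappa> a u 1 = c\<^sub>1" "left_coeff \<kappa> a u 2 = c\<^sub>2"
proof -
  have A12: "A $ 1 $ 2 \<noteq> 0" using less by auto
  have ev: "eigenvalues A = {A $ 1 $ 2 * c\<^sub>1 + A $ 2 $ 2, A $ 1 $ 2 * c\<^sub>2 + A $ 2 $ 2}"
    using A12 roots by (rule eigenvalues_2)
  have l: "flux_eigenvalue \<kappa> a u 1 = A $ 1 $ 2 * c\<^sub>1 + A $ 2 $ 2"
      "flux_eigenvalue \<kappa> a u 2 = A $ 1 $ 2 * c\<^sub>2 + A $ 2 $ 2"
    using less by (auto simp: flux_eigenvalue_def ev simp flip: A)
  have *: "(THE c. vector [c, 1] v* A = (A $ 1 $ 2 * d + A $ 2 $ 2) *\<^sub>R vector [c, 1]) = d"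
    if "A $ 1 $ 2 * d\<^sup>2 + (A $ 2 $ 2 - A $ 1 $ 1) * d - A $ 2 $ 1 = 0" for d
  proof (rule the_equality)
    show "vector [d, 1] v* A = (A $ 1 $ 2 * d + A $ 2 $ 2) *\<^sub>R vector [d, 1]"
      using that
      by (simp add: vec_eq_iff forall_2 vector_matrix_mult_def sum_2 algebra_simps power2_eq_square)
  next
    fix c :: real
    assume "vector [c, 1] v* A = (A $ 1 $ 2 * d + A $ 2 $ 2) *\<^sub>R vector [c, 1]"
    \<comment> \<open>Comparing second components gives
      \<open>A $ 1 $ 2 * c = A $ 1 $ 2 * d\<close>.\<close>
    then show "c = d"
      using A12 by (simp add: vec_eq_iff forall_2 vector_matrix_mult_def sum_2)
  qed
  show "left_coeff \<kappa> a u 1 = c\<^sub>1" "left_coeff \<kappa> a u 2 = c\<^sub>2"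
    unfolding left_coeff_def l A[symmetric] by (rule *, simp add: roots)+
qed

section \<open>The inverse of R and the diagonal coupling coefficients\<close>

lemma matrix_inv_eqI:
  fixes A B :: "real^'n^'n"
  assumes "A ** B = mat 1"
  shows "matrix_inv A = B"
proof -
  have "B ** A = mat 1"
    using assms by (simp add: matrix_left_right_inverse)
  have "A ** matrix_inv A = mat 1 \<and> matrix_inv A ** A = mat 1"
    unfolding matrix_inv_def
    by (rule someI[of _ B]) (use assms \<open>B ** A = mat 1\<close> in simp)
  with \<open>B ** A = mat 1\<close> show ?thesis
    by (metis matrix_mul_assoc matrix_mul_lid matrix_mul_rid)
qed

text \<open>The columns form the basis dual to the rows of R: the first is proportional to
  \<open>(1, - c\<^sub>2)\<close> and is killed by \<open>(c\<^sub>2, 1)\<close>, the second to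
  \<open>(- 1, c\<^sub>1)\<close> and is killed by \<open>(c\<^sub>1, 1)\<close>.\<close>

lemma matrix_inv_Rmat:
  assumes "left_coeff \<kappa> a u 1 = c\<^sub>1" "left_coeff \<kappa> a u 2 = c\<^sub>2" "c\<^sub>1 \<noteq> c\<^sub>2"
  shows "matrix_inv (Rmat \<kappa> a u) = vector
    [vector [1 / (c\<^sub>1 - c\<^sub>2), - 1 / (c\<^sub>1 - c\<^sub>2)], vector [- c\<^sub>2 / (c\<^sub>1 - c\<^sub>2), c\<^sub>1 / (c\<^sub>1 - c\<^sub>2)]]"
  (is "_ = ?S")
proof -
  have "Rmat \<kappa> a u ** ?S = mat 1"
    using assms
    by (intro matrix_2_eqI)
       (simp_all add: Rmat_def matrix_matrix_mult_def sum_2 mat_def flip: diff_divide_distrib)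
  then show ?thesis
    by (rule matrix_inv_eqI)
qed

text \<open>A diagonal entry is half the second derivative of \<open>d\<close> times the first flux
  component plus the second, along a column of the inverse of R. The quadratic part of the flux
  yields the factor \<open>c\<^sub>2 - d\<close> or \<open>c\<^sub>1 - d\<close>; the term in \<E>^2
  / \<rho> yields the square.\<close>

lemma coupling_diagonal:
  assumes "\<kappa> \<noteq> 1" "u $ 1 \<noteq> 0"
    and c: "left_coeff \<kappa> a u 1 = c\<^sub>1" "left_coeff \<kappa> a u 2 = c\<^sub>2" "c\<^sub>1 \<noteq> c\<^sub>2"
    and d: "d = left_coeff \<kappa> a u i"
  shows "coupling \<kappa> a u i $ 1 $ 1 = ((\<kappa> - 1) * (a $ 1 - a $ 2 * c\<^sub>2) * (c\<^sub>2 - d)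
      + (\<kappa> - 2) * a $ 2 * (u $ 1 * c\<^sub>2 + u $ 2)\<^sup>2 / (u $ 1) ^ 3) / (c\<^sub>1 - c\<^sub>2)\<^sup>2"
    and "coupling \<kappa> a u i $ 2 $ 2 = ((\<kappa> - 1) * (a $ 1 - a $ 2 * c\<^sub>1) * (c\<^sub>1 - d)
      + (\<kappa> - 2) * a $ 2 * (u $ 1 * c\<^sub>1 + u $ 2)\<^sup>2 / (u $ 1) ^ 3) / (c\<^sub>1 - c\<^sub>2)\<^sup>2"
proof -
  have R: "Rmat \<kappa> a u $ i $ 1 = d" "Rmat \<kappa> a u $ i $ 2 = 1"
    using exhaust_2[of i] d by (auto simp: Rmat_def)
  note simps = coupling_def Let_def sum_2 R matrix_inv_Rmat[OF c] flux_hessian_1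
    flux_hessian_2[OF assms(1,2)] matrix_matrix_mult_def transpose_def
  \<comment> \<open>Naming the difference keeps the denominators atomic while they are
    cleared.\<close>
  define D where "D = c\<^sub>1 - c\<^sub>2"
  have D: "D \<noteq> 0" using c by (simp add: D_def)
  show "coupling \<kappa> a u i $ 1 $ 1 = ((\<kappa> - 1) * (a $ 1 - a $ 2 * c\<^sub>2) * (c\<^sub>2 - d)
      + (\<kappa> - 2) * a $ 2 * (u $ 1 * c\<^sub>2 + u $ 2)\<^sup>2 / (u $ 1) ^ 3) / (c\<^sub>1 - c\<^sub>2)\<^sup>2"
    using assms(2) D unfolding D_def[symmetric]
    by (simp add: simps flip: D_def) (simp add: field_simps eval_nat_numeral)
  show "coupling \<kappa> a u i $ 2 $ 2 = ((\<kappa> - 1) * (a $ 1 - a $ 2 * c\<^sub>1) * (c\<^sub>1 - d)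
      + (\<kappa> - 2) * a $ 2 * (u $ 1 * c\<^sub>1 + u $ 2)\<^sup>2 / (u $ 1) ^ 3) / (c\<^sub>1 - c\<^sub>2)\<^sup>2"
    using assms(2) D unfolding D_def[symmetric]
    by (simp add: simps flip: D_def) (simp add: field_simps eval_nat_numeral)
qed

section \<open>Separation of the roots and nonvanishing of the coefficients\<close>

lemma quadratic_split:
  fixes A B C x :: real
  assumes "A * (A * x\<^sup>2 + B * x + C) < 0"
  obtains c\<^sub>1 c\<^sub>2 where "A * c\<^sub>2 < A * c\<^sub>1" "c\<^sub>1 \<noteq> x" "c\<^sub>2 \<noteq> x"
    "\<And>c. A * c\<^sup>2 + B * c + C = A * (c - c\<^sub>1) * (c - c\<^sub>2)"
proof -
  have A: "A \<noteq> 0" using assms by auto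
  \<comment> \<open>With p the quadratic, the discriminant is p'(x)^2 - 4 A p(x), and the hypothesis
    makes the last term contribute positively.\<close>
  have "B\<^sup>2 - 4 * A * C = (2 * A * x + B)\<^sup>2 - 4 * (A * (A * x\<^sup>2 + B * x + C))"
    by algebra
  then have disc: "B\<^sup>2 - 4 * A * C > 0"
    using assms by (smt (verit) zero_le_power2)
  define s where "s = sqrt (B\<^sup>2 - 4 * A * C)"
  have s: "s > 0" "s\<^sup>2 = B\<^sup>2 - 4 * A * C"
    using disc by (auto simp: s_def)
  \<comment> \<open>With this choice \<open>A * c\<^sub>1 - A * c\<^sub>2 = s\<close> for either
    sign of \<open>A\<close>.\<close>
  define c\<^sub>1 c\<^sub>2 where "c\<^sub>1 = (- B + s) / (2 * A)" and "c\<^sub>2 = (- B - s) / (2 * A)"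
  have B: "B = - A * (c\<^sub>1 + c\<^sub>2)"
    using A by (simp add: c\<^sub>1_def c\<^sub>2_def field_simps)
  have "4 * A * (A * (c\<^sub>1 * c\<^sub>2)) = (2 * A * c\<^sub>1) * (2 * A * c\<^sub>2)"
    by algebra
  also have "\<dots> = (- B + s) * (- B - s)"
    using A by (simp add: c\<^sub>1_def c\<^sub>2_def)
  also have "\<dots> = 4 * A * C"
    using s(2) by algebra
  finally have C: "C = A * (c\<^sub>1 * c\<^sub>2)"
    using A by simp
  have factor: "A * c\<^sup>2 + B * c + C = A * (c - c\<^sub>1) * (c - c\<^sub>2)" for c
    unfolding B C by algebra
  show ?thesis
  proof
    show "A * c\<^sub>2 < A * c\<^sub>1"
      using A s(1) by (simp add: c\<^sub>1_def c\<^sub>2_def)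
    show "c\<^sub>1 \<noteq> x" "c\<^sub>2 \<noteq> x"
      using assms unfolding factor by auto
  qed (rule factor)
qed

lemma coupling_nonzero:
  assumes \<kappa>: "\<kappa> > 2" and u: "0 < u $ 1" "u $ 1 < 1" "u $ 1 < u $ 2" "u $ 2 < \<kappa> * u $ 1"
    and a: "a $ 2 \<noteq> 0"
  shows "coupling \<kappa> a u 1 $ 2 $ 2 \<noteq> 0" "coupling \<kappa> a u 2 $ 1 $ 1 \<noteq> 0"
proof -
  define A where "A = flux_jacobian \<kappa> a u"
  have nz: "\<kappa> \<noteq> 1" "u $ 1 \<noteq> 0" using \<kappa> u by auto
  define x where "x = u $ 2 / u $ 1"
  have u2: "u $ 2 = x * u $ 1" and x: "1 < x" "x < \<kappa>"
    using u by (auto simp: x_def field_simps)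
  note A_entries = A_def flux_jacobian_eq[OF nz]
  have A12: "A $ 1 $ 2 = (\<kappa> - 1) * a $ 2 * (1 - u $ 1)"
    by (simp add: A_entries)
  have "A $ 1 $ 2 * (- x)\<^sup>2 + (A $ 2 $ 2 - A $ 1 $ 1) * (- x) + (- A $ 2 $ 1)
      = a $ 2 * (x - 1) * (x - \<kappa>)"
    using nz(2) by (simp add: A_entries u2 power_mult_distrib) (simp add: algebra_simps power2_eq_square)
  \<comment> \<open>Multiplying by \<open>A $ 1 $ 2\<close> turns \<open>a $ 2\<close> into its
    square, so no case split on its sign arises.\<close>
  then have "A $ 1 $ 2 * (A $ 1 $ 2 * (- x)\<^sup>2 + (A $ 2 $ 2 - A $ 1 $ 1) * (- x) + (- A $ 2 $ 1))
      = - ((\<kappa> - 1) * (1 - u $ 1) * (x - 1) * (\<kappa> - x) * (a $ 2)\<^sup>2)"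
    unfolding A12 by algebra
  also have "\<dots> < 0"
    using \<kappa> u x a by simp
  finally obtain c\<^sub>1 c\<^sub>2 where less: "A $ 1 $ 2 * c\<^sub>2 < A $ 1 $ 2 * c\<^sub>1"
    and ne: "c\<^sub>1 \<noteq> - x" "c\<^sub>2 \<noteq> - x"
    and roots: "\<And>c. A $ 1 $ 2 * c\<^sup>2 + (A $ 2 $ 2 - A $ 1 $ 1) * c + (- A $ 2 $ 1)
      = A $ 1 $ 2 * (c - c\<^sub>1) * (c - c\<^sub>2)"
    by (rule quadratic_split) (rule that)
  have c: "left_coeff \<kappa> a u 1 = c\<^sub>1" "left_coeff \<kappa> a u 2 = c\<^sub>2" "c\<^sub>1 \<noteq> c\<^sub>2"
    using left_coeff_eq[OF nz A_def _ less] roots less by auto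
  have "u $ 1 * d + u $ 2 \<noteq> 0" if "d \<noteq> - x" for d
    using that nz(2) by (simp add: u2 flip: distrib_left add: mult.commute[of x]) 
  \<comment> \<open>Here \<open>d\<close> is \<open>c\<^sub>1\<close> in the first entry and
    \<open>c\<^sub>2\<close> in the second, so only the square term survives, with nonzero factor
    \<open>(\<kappa> - 2) * a $ 2\<close>.\<close>
  then show "coupling \<kappa> a u 1 $ 2 $ 2 \<noteq> 0" "coupling \<kappa> a u 2 $ 1 $ 1 \<noteq> 0"
    using coupling_diagonal[OF nz c refl] ne \<kappa> a nz c by simp_all
qed

text \<open>At this point the quadratic is c^2 + 4 c + 3, with the rational roots -1 and -3; both
  coefficients evaluate to -1/2.\<close>

lemma coupling_example:
  defines "a \<equiv> vector [- 2, 1]" and "u \<equiv> vector [1/2, 1]"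
  shows "coupling 3 a u 1 $ 1 $ 1 \<noteq> 0" "coupling 3 a u 2 $ 2 $ 2 \<noteq> 0"
proof -
  have nz: "(3::real) \<noteq> 1" "u $ 1 \<noteq> 0" by (simp_all add: u_def)
  define A where "A = flux_jacobian 3 a u"
  have A: "A $ 1 $ 1 = -2" "A $ 1 $ 2 = 1" "A $ 2 $ 1 = -3" "A $ 2 $ 2 = 2"
    unfolding A_def flux_jacobian_eq[OF nz] by (simp_all add: a_def u_def power2_eq_square)
  have c: "left_coeff 3 a u 1 = -1" "left_coeff 3 a u 2 = -3"
    by (rule left_coeff_eq[OF nz A_def, where c\<^sub>1 = "-1" and c\<^sub>2 = "-3"];
        simp add: A algebra_simps power2_eq_square)+
  show "coupling 3 a u 1 $ 1 $ 1 \<noteq> 0" "coupling 3 a u 2 $ 2 $ 2 \<noteq> 0"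
    using coupling_diagonal(1)[OF nz c _ c(1)[symmetric]]
      coupling_diagonal(2)[OF nz c _ c(2)[symmetric]]
    by (simp_all add: a_def u_def power2_eq_square power3_eq_cube)
qed

theorem proposition46:
  shows "(\<forall>\<kappa> \<rho> \<E> \<alpha>\<^sub>p \<alpha>\<^sub>e. admissible \<kappa> \<rho> \<E> \<alpha>\<^sub>p \<alpha>\<^sub>e \<longrightarrow>
            G \<kappa> \<rho> \<E> \<alpha>\<^sub>p \<alpha>\<^sub>e 1 $ 2 $ 2 \<noteq> 0 \<and> G \<kappa> \<rho> \<E> \<alpha>\<^sub>p \<alpha>\<^sub>e 2 $ 1 $ 1 \<noteq> 0)
       \<and> (\<exists>\<kappa> \<rho> \<E> \<alpha>\<^sub>p \<alpha>\<^sub>e. admissible \<kappa> \<rho> \<E> \<alpha>\<^sub>p \<alpha>\<^sub>e \<and>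
            G \<kappa> \<rho> \<E> \<alpha>\<^sub>p \<alpha>\<^sub>e 1 $ 1 $ 1 \<noteq> 0 \<and> G \<kappa> \<rho> \<E> \<alpha>\<^sub>p \<alpha>\<^sub>e 1 $ 2 $ 2 \<noteq> 0 \<and>
            G \<kappa> \<rho> \<E> \<alpha>\<^sub>p \<alpha>\<^sub>e 2 $ 1 $ 1 \<noteq> 0 \<and> G \<kappa> \<rho> \<E> \<alpha>\<^sub>p \<alpha>\<^sub>e 2 $ 2 $ 2 \<noteq> 0)"
proof (rule conjI)
  show general: "\<forall>\<kappa> \<rho> \<E> \<alpha>\<^sub>p \<alpha>\<^sub>e. admissible \<kappa> \<rho> \<E> \<alpha>\<^sub>p \<alpha>\<^sub>e \<longrightarrow>
      G \<kappa> \<rho> \<E> \<alpha>\<^sub>p \<alpha>\<^sub>e 1 $ 2 $ 2 \<noteq> 0 \<and> G \<kappa> \<rho> \<E> \<alpha>\<^sub>p \<alpha>\<^sub>e 2 $ 1 $ 1 \<noteq> 0"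
    unfolding admissible_def by (intro allI impI conjI coupling_nonzero) auto
  have "admissible 3 (1/2) 1 (- 2) 1"
    by (simp add: admissible_def)
  \<comment> \<open>\<open>general\<close> covers two of the four entries at the witness and
    \<open>coupling_example\<close> the other two; \<open>of_int_numeral\<close> identifies the
    integer 3 with the real one.\<close>
  with general coupling_example
  show "\<exists>\<kappa> \<rho> \<E> \<alpha>\<^sub>p \<alpha>\<^sub>e. admissible \<kappa> \<rho> \<E> \<alpha>\<^sub>p \<alpha>\<^sub>e \<and>
            G \<kappa> \<rho> \<E> \<alpha>\<^sub>p \<alpha>\<^sub>e 1 $ 1 $ 1 \<noteq> 0 \<and> G \<kappa> \<rho> \<E> \<alpha>\<^sub>p \<alpha>\<^sub>e 1 $ 2 $ 2 \<noteq> 0 \<and>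
            G \<kappa> \<rho> \<E> \<alpha>\<^sub>p \<alpha>\<^sub>e 2 $ 1 $ 1 \<noteq> 0 \<and> G \<kappa> \<rho> \<E> \<alpha>\<^sub>p \<alpha>\<^sub>e 2 $ 2 $ 2 \<noteq> 0"
    by (metis of_int_numeral)
qed

end
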